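(* Let $\mathcal{G}$ be a $k$-uniform $d$-regular hypergraph, with adjacency tensor $\mathcal{A}_{\mathcal{G}}$. Then the number of connected components of $\mathcal{G}$ equals $\beta_{\rho}(\mathcal{G})$, the maximum number of linearly independent nonnegative eigenvectors of $\mathcal{A}_{\mathcal{G}}$ corresponding to the spectral radius $\rho(\mathcal{A}_{\mathcal{G}})$.
   Context: A $k$-uniform hypergraph $\mathcal{G}$ has vertex set $[n]$ and an edge set $E(\mathcal{G})$ of $k$-element subsets of $[n]$; it is $d$-regular if every vertex lies in exactly $d$ edges. A path is an alternating sequence $v_0e_1v_1\cdots e_lv_l$ of distinct vertices and distinct edges with $v_{i-1},v_i\in e_i$. For $X\subseteq V$, $\mathcal{G}(X)$ is the induced sub-hypergraph; it is a connected component if any two vertices of $X$ are joined by a path in $\mathcal{G}(X)$ and no path joins a vertex of $X$ to a vertex of $V\setminus X$. The adjacency tensor $\mathcal{A}_{\mathcal{G}}=(a_{i_1\cdots i_k})$ is the $k$-order $n$-dimensional tensor with $a_{i_1\cdots i_k}=\frac{1}{(k-1)!}$ if $\{i_1,\dots,i_k\}\in E(\mathcal{G})$ and $0$ otherwise. For a $k$-order $n$-dimensional tensor $\mathcal{T}=(t_{i_1\cdots i_k})$ and $x\in\mathbb{C}^n$, $(\mathcal{T}x^{k-1})_i=\sum_{i_2,\dots,i_k=1}^n t_{i i_2\cdots i_k}x_{i_2}\cdots x_{i_k}$; $\lambda\in\mathbb{C}$ is an eigenvalue with eigenvector $x\neq0$ if $\mathcal{T}x^{k-1}=\lambda x^{[k-1]}$,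 where $x^{[k-1]}=(x_1^{k-1},\dots,x_n^{k-1})^{\mathrm T}$. The spectral radius $\rho(\mathcal{T})$ is the maximum modulus of an eigenvalue of $\mathcal{T}$. $\beta_\rho(\mathcal{G})$ is the maximum number of linearly independent vectors $x\in\mathbb{R}^n_+\setminus\{0\}$ with $\mathcal{A}_{\mathcal{G}}x^{k-1}=\rho(\mathcal{A}_{\mathcal{G}})x^{[k-1]}$. *)

theory Defs
  imports "HOL-Analysis.Analysis"
begin

text \<open>
  The vertex set \<open>[n]\<close> is the universe of a finite type \<open>'n\<close>, so that \<open>n = CARD('n)\<close>;
  a hypergraph on it is given by its edge set.
\<close>

definition uniform_hypergraph :: "nat \<Rightarrow> 'n::finite set set \<Rightarrow> bool" where
  "uniform_hypergraph k E \<longleftrightarrow> (\<forall>e\<in>E. card e = k)"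

definition regular_hypergraph :: "nat \<Rightarrow> 'n::finite set set \<Rightarrow> bool" where
  "regular_hypergraph d E \<longleftrightarrow> (\<forall>v. card {e \<in> E. v \<in> e} = d)"

text \<open>
  The path \<open>v\<^sub>0 e\<^sub>1 v\<^sub>1 \<dots> e\<^sub>l v\<^sub>l\<close> is represented by the lists \<open>[v\<^sub>0, \<dots>, v\<^sub>l]\<close> and
  \<open>[e\<^sub>1, \<dots>, e\<^sub>l]\<close>; since lists are indexed from 0, \<open>es ! i\<close> is \<open>e\<^sub>i\<^sub>+\<^sub>1\<close>.
  The case \<open>l = 0\<close> is allowed.
\<close>

definition hg_path :: "'n set \<Rightarrow> 'n set set \<Rightarrow> 'n list \<Rightarrow> 'n set list \<Rightarrow> bool" where
  "hg_path V E vs es \<longleftrightarrow>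
     length vs = Suc (length es) \<and> set vs \<subseteq> V \<and> set es \<subseteq> E \<and> distinct vs \<and> distinct es \<and>
     (\<forall>i<length es. vs ! i \<in> es ! i \<and> vs ! Suc i \<in> es ! i)"

definition hg_joined :: "'n set \<Rightarrow> 'n set set \<Rightarrow> 'n \<Rightarrow> 'n \<Rightarrow> bool" where
  "hg_joined V E u v \<longleftrightarrow> (\<exists>vs es. hg_path V E vs es \<and> hd vs = u \<and> last vs = v)"

definition induced_edges :: "'n set set \<Rightarrow> 'n set \<Rightarrow> 'n set set" where
  "induced_edges E X = {e \<in> E. e \<subseteq> X}"

definition hg_component :: "'n::finite set set \<Rightarrow> 'n set \<Rightarrow> bool" where
  "hg_component E X \<longleftrightarrow> X \<noteq> {} \<and>
     (\<forall>u\<in>X. \<forall>v\<in>X. hg_joined X (induced_edges E X) u v) \<and>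
     (\<forall>u\<in>X. \<forall>v\<in>UNIV - X. \<not> hg_joined UNIV E u v)"

text \<open>
  A tensor of order \<open>k\<close> and dimension \<open>n\<close> is a function on index lists, of which only
  the values on lists \<open>[i\<^sub>1, \<dots>, i\<^sub>k]\<close> of length \<open>k\<close> are ever used (for \<open>k \<ge> 1\<close>).
\<close>

definition tensor_apply :: "nat \<Rightarrow> ('n::finite list \<Rightarrow> complex) \<Rightarrow> complex ^ 'n \<Rightarrow> complex ^ 'n" where
  "tensor_apply k T x =
     (\<chi> i. \<Sum>js | length js = k - 1. T (i # js) * prod_list (map (\<lambda>j. x $ j) js))"

definition tensor_eigenpair ::
    "nat \<Rightarrow> ('n::finite list \<Rightarrow> complex) \<Rightarrow> complex \<Rightarrow> complex ^ 'n \<Rightarrow> bool" where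
  "tensor_eigenpair k T c x \<longleftrightarrow> x \<noteq> 0 \<and> tensor_apply k T x = (\<chi> i. c * (x $ i) ^ (k - 1))"

definition tensor_spectral_radius :: "nat \<Rightarrow> ('n::finite list \<Rightarrow> complex) \<Rightarrow> real" where
  "tensor_spectral_radius k T = (GREATEST r. \<exists>c x. tensor_eigenpair k T c x \<and> r = cmod c)"

definition adjacency_tensor :: "nat \<Rightarrow> 'n::finite set set \<Rightarrow> 'n list \<Rightarrow> complex" where
  "adjacency_tensor k E is = (if set is \<in> E then 1 / fact (k - 1) else 0)"

definition rho_nonneg_eigenvectors :: "nat \<Rightarrow> 'n::finite set set \<Rightarrow> (real ^ 'n) set" where
  "rho_nonneg_eigenvectors k E =
     {x. (\<forall>i. 0 \<le> x $ i) \<and>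
         tensor_eigenpair k (adjacency_tensor k E)
           (complex_of_real (tensor_spectral_radius k (adjacency_tensor k E)))
           (\<chi> i. complex_of_real (x $ i))}"

text \<open>
  The maximum is over a finite set, as independent subsets of \<open>\<real>\<^sup>n\<close> are finite with at
  most \<open>n\<close> elements.
\<close>

definition beta_rho :: "nat \<Rightarrow> 'n::finite set set \<Rightarrow> nat" where
  "beta_rho k E = Max {card S | S. S \<subseteq> rho_nonneg_eigenvectors k E \<and> independent S}"

end

theory Submission
  imports Defs "HOL-Combinatorics.Multiset_Permutations"
begin

text \<open>
  For a uniform hypergraph, \<open>(\<A> x\<^sup>k\<^sup>-\<^sup>1)\<^sub>i\<close> is the sum over the edges \<open>e\<close> at \<open>i\<close> of the products
  of \<open>x\<^sub>j\<close> over \<open>j \<in> e - {i}\<close>. Comparing both sides of the eigenvalue equation at a coordinate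
  of largest modulus shows that the spectral radius is \<open>d\<close>. A nonnegative vector is an eigenvector
  for \<open>d\<close> iff it is nonzero and constant on every edge: otherwise take, among the vertices having
  a neighbour with a different value, one where \<open>x\<close> is largest; there the equation fails strictly.
  The vectors that are constant on edges are spanned by the indicator vectors of the connected
  components, which are nonzero and pairwise orthogonal.
\<close>

section \<open>Adjacency, paths and connected components\<close>

text \<open>Passing to the reflexive transitive closure of this relation removes the distinctness
  conditions of paths. A vertex in no edge becomes a singleton class by reflexivity.\<close>

definition hg_adjacent :: "'n set set \<Rightarrow> ('n \<times> 'n) set" where
  "hg_adjacent E = {(u, v). \<exists>e\<in>E. u \<in> e \<and> v \<in> e}"

lemma equiv_rtrancl_hg_adjacent: "equiv UNIV ((hg_adjacent E)\<^sup>*)"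
proof (rule equivI)
  have "sym (hg_adjacent E)"
    by (auto simp: hg_adjacent_def sym_def)
  then show "sym ((hg_adjacent E)\<^sup>*)"
    by (rule sym_rtrancl)
qed (auto simp: refl_rtrancl trans_rtrancl)

lemma hg_joined_refl: "u \<in> V \<Longrightarrow> hg_joined V E u u"
  unfolding hg_joined_def hg_path_def
  by (rule exI[of _ "[u]"], rule exI[of _ "[]"]) simp

text \<open>Appending \<open>e\<close> and \<open>w\<close> directly could repeat a vertex or an
  edge. If \<open>w\<close> already occurs, the path is truncated there; otherwise it branches off
  early enough that \<open>e\<close> is new.\<close>

lemma hg_joined_step:
  assumes "hg_joined V E u v" "e \<in> E" "v \<in> e" "w \<in> e" "w \<in> V"
  shows "hg_joined V E u w"
proof -
  from assms(1) obtain vs es where p: "hg_path V E vs es" and hd: "hd vs = u" and last: "last vs = v"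
    by (auto simp: hg_joined_def)
  have len: "length vs = Suc (length es)" and vsV: "set vs \<subseteq> V" and esE: "set es \<subseteq> E"
    and dvs: "distinct vs" and des: "distinct es"
    and inc: "\<And>i. i < length es \<Longrightarrow> vs ! i \<in> es ! i \<and> vs ! Suc i \<in> es ! i"
    using p by (auto simp: hg_path_def)
  show ?thesis
  proof (cases "w \<in> set vs")
    case True
    then obtain m where m: "m < length vs" "vs ! m = w"
      by (auto simp: in_set_conv_nth)
    \<comment> \<open>The vertex of index \<open>m\<close> is reached after \<open>m\<close> edges,
      hence the two different lengths.\<close>
    have "hg_path V E (take (Suc m) vs) (take m es)"
      unfolding hg_path_def using len vsV esE dvs des inc m
      by (auto dest!: in_set_takeD)
    moreover have "hd (take (Suc m) vs) = u" "last (take (Suc m) vs) = w"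
      using hd m by (auto simp: take_Suc_conv_app_nth hd_append hd_conv_nth split: if_splits)
    ultimately show ?thesis
      unfolding hg_joined_def by blast
  next
    case False
    \<comment> \<open>Cutting the path at its first vertex on \<open>e\<close> ensures that \<open>e\<close> has not been used before.\<close>
    define m where "m = (LEAST i. i < length vs \<and> vs ! i \<in> e)"
    \<comment> \<open>The last vertex \<open>v\<close> lies on \<open>e\<close>, so
      \<open>LEAST\<close> ranges over a nonempty set.\<close>
    have "length es < length vs \<and> vs ! length es \<in> e"
      using len last assms(3) by (cases vs rule: rev_cases) (auto simp: nth_append)
    then have m: "m < length vs" "vs ! m \<in> e"
      unfolding m_def by (metis (mono_tags, lifting) LeastI)+
    have before: "vs ! j \<notin> e" if "j < m" for j
      using that m(1) not_less_Least[of j "\<lambda>i. i < length vs \<and> vs ! i \<in> e"]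
      by (auto simp: m_def)
    \<comment> \<open>If \<open>e\<close> were among the first \<open>m\<close> edges, the path
      vertex just before it would lie on \<open>e\<close> and have index below
      \<open>m\<close>.\<close>
    have enew: "e \<notin> set (take m es)"
      using before inc m(1) len by (force simp: in_set_conv_nth)
    have "hg_path V E (take (Suc m) vs @ [w]) (take m es @ [e])"
      unfolding hg_path_def
    proof (intro conjI allI impI)
      show "length (take (Suc m) vs @ [w]) = Suc (length (take m es @ [e]))"
        using m len by simp
      show "set (take (Suc m) vs @ [w]) \<subseteq> V" "set (take m es @ [e]) \<subseteq> E"
        using vsV esE assms by (auto dest!: in_set_takeD)
      show "distinct (take (Suc m) vs @ [w])" "distinct (take m es @ [e])"
        using dvs des False enew by (auto dest!: in_set_takeD)
      fix i assume "i < length (take m es @ [e])"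
      then have "i \<le> m"
        using m len by simp
      then show "(take (Suc m) vs @ [w]) ! i \<in> (take m es @ [e]) ! i"
        "(take (Suc m) vs @ [w]) ! Suc i \<in> (take m es @ [e]) ! i"
        using m len inc[of i] assms(4) by (cases "i = m"; simp add: nth_append)+
    qed
    moreover have "hd (take (Suc m) vs @ [w]) = u" "last (take (Suc m) vs @ [w]) = w"
      using hd m by (auto simp: hd_append)
    ultimately show ?thesis
      unfolding hg_joined_def by blast
  qed
qed

lemma hg_joined_imp_rtrancl:
  assumes "hg_joined V E u v"
  shows "(u, v) \<in> (hg_adjacent E)\<^sup>*"
proof -
  from assms obtain vs es where p: "hg_path V E vs es" and hd: "hd vs = u" and last: "last vs = v"
    by (auto simp: hg_joined_def)
  have len: "length vs = Suc (length es)"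
    using p by (simp add: hg_path_def)
  have adj: "(vs ! i, vs ! Suc i) \<in> hg_adjacent E" if "i < length es" for i
    using p that nth_mem[OF that] unfolding hg_path_def hg_adjacent_def by blast
  have "i < length vs \<Longrightarrow> (vs ! 0, vs ! i) \<in> (hg_adjacent E)\<^sup>*" for i
    by (induction i) (auto simp: len intro: rtrancl_into_rtrancl adj)
  from this[of "length es"] show ?thesis
    using hd last len by (metis diff_Suc_1 hd_conv_nth last_conv_nth lessI list.size(3) nat.distinct(1))
qed

text \<open>The outer condition on a component makes it closed under adjacency, and the inner one
  keeps it within a single class. Conversely, a chain of adjacencies that starts in a class never
  leaves it, so it yields a path in the induced sub-hypergraph.\<close>

lemma hg_components_eq_quotient:
  "{X. hg_component E X} = UNIV // (hg_adjacent E)\<^sup>*" (is "_ = UNIV // ?R")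
proof (intro equalityI subsetI)
  fix X assume "X \<in> {X. hg_component E X}"
  then obtain u where u: "u \<in> X"
    and inner: "\<And>v. v \<in> X \<Longrightarrow> hg_joined X (induced_edges E X) u v"
    and outer: "\<And>v w. v \<in> X \<Longrightarrow> w \<notin> X \<Longrightarrow> \<not> hg_joined UNIV E v w"
    by (auto simp: hg_component_def)
  have "(u, v) \<in> ?R" if "v \<in> X" for v
  proof -
    have "hg_adjacent (induced_edges E X) \<subseteq> hg_adjacent E"
      by (auto simp: hg_adjacent_def induced_edges_def)
    then show ?thesis
      using hg_joined_imp_rtrancl[OF inner[OF that]] by (meson in_mono rtrancl_mono)
  qed
  \<comment> \<open>A step from \<open>y\<close> in \<open>X\<close> to \<open>z\<close> outside
    \<open>X\<close> would be a path with one edge, contrary to \<open>outer\<close>.\<close>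
  moreover have "v \<in> X" if "(u, v) \<in> ?R" for v
    using that
  proof induction
    case (step y z)
    then show ?case
      using outer[of y z] hg_joined_step[OF hg_joined_refl[of y UNIV E]]
      by (auto simp: hg_adjacent_def)
  qed (rule u)
  ultimately have "X = ?R `` {u}"
    by auto
  then show "X \<in> UNIV // ?R"
    by (simp add: quotientI)
next
  fix X assume X: "X \<in> UNIV // ?R"
  have closed: "v \<in> X \<longleftrightarrow> u \<in> X" if "(u, v) \<in> ?R" for u v
    using that in_quotient_imp_closed[OF equiv_rtrancl_hg_adjacent X]
      equiv_rtrancl_hg_adjacent[of E] by (blast elim: equivE dest: symD)
  have "hg_joined X (induced_edges E X) u v" if "u \<in> X" "v \<in> X" for u v
  proof -
    have "(u, v) \<in> ?R"
      using in_quotient_imp_in_rel[OF equiv_rtrancl_hg_adjacent X] that by blast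
    then show ?thesis
    proof induction
      case base
      show ?case using \<open>u \<in> X\<close> by (rule hg_joined_refl)
    next
      case (step y z)
      have yX: "y \<in> X"
        using closed[OF step(1)] \<open>u \<in> X\<close> by blast
      obtain e where e: "e \<in> E" "y \<in> e" "z \<in> e"
        using step(2) by (auto simp: hg_adjacent_def)
      \<comment> \<open>Every vertex of \<open>e\<close> is adjacent to \<open>y\<close>, so
        \<open>e\<close> lies in the class and survives in the induced sub-hypergraph.\<close>
      have sub: "e \<subseteq> X"
      proof
        fix t assume "t \<in> e"
        with e have "(y, t) \<in> ?R"
          by (auto simp: hg_adjacent_def)
        then show "t \<in> X"
          using closed yX by blast
      qed
      then show ?case
        using e by (intro hg_joined_step[OF step.IH, of e]) (auto simp: induced_edges_def)
    qed
  qed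
  moreover have "X \<noteq> {}"
    using in_quotient_imp_non_empty[OF equiv_rtrancl_hg_adjacent X] .
  ultimately show "X \<in> {X. hg_component E X}"
    using closed hg_joined_imp_rtrancl[of UNIV E] unfolding hg_component_def by blast
qed

section \<open>The adjacency tensor as a sum over edges\<close>

lemma card_edge_remove:
  "uniform_hypergraph k E \<Longrightarrow> e \<in> E \<Longrightarrow> i \<in> e \<Longrightarrow> card (e - {i}) = k - 1"
  by (simp add: uniform_hypergraph_def)

text \<open>The index lists that contribute for an edge \<open>e\<close> at \<open>i\<close> are the
  orderings of \<open>e - {i}\<close>, all with the same product; the weight
  \<open>1 / fact (k - 1)\<close> cancels their number.\<close>

lemma tensor_apply_adjacency:
  fixes E :: "'n::finite set set"
  assumes "uniform_hypergraph k E" "k \<ge> 1"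
  shows "tensor_apply k (adjacency_tensor k E) x $ i = (\<Sum>e | e \<in> E \<and> i \<in> e. \<Prod>j\<in>e - {i}. x $ j)"
proof -
  let ?J = "{js :: 'n list. length js = k - 1 \<and> insert i (set js) \<in> E}"
  have fin: "finite {js :: 'n list. length js = k - 1}"
    using finite_lists_length_eq[of "UNIV :: 'n set" "k - 1"] by simp
  have perms: "{js \<in> ?J. insert i (set js) = e} = permutations_of_set (e - {i})"
    if e: "e \<in> E" "i \<in> e" for e
  proof -
    have ce: "card (e - {i}) = k - 1" "card e = k"
      using assms e by (auto simp: uniform_hypergraph_def)
    \<comment> \<open>Together \<open>i\<close> and the \<open>k - 1\<close> entries of
      \<open>js\<close> cover \<open>k\<close> elements, which leaves room neither for a repetition
      nor for \<open>i\<close> among the entries.\<close>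
    have forward: "set js = e - {i} \<and> distinct js" if js: "length js = k - 1" "insert i (set js) = e" for js
    proof -
      have "card (insert i (set js)) = k" "card (set js) \<le> k - 1"
        using js ce card_length[of js] by auto
      then have "card (set js) = length js" "i \<notin> set js"
        using js(1) assms(2) by (auto simp: card_insert_if split: if_splits)
      then show ?thesis
        using js(2) by (auto intro: card_distinct)
    qed
    have backward: "length js = k - 1 \<and> insert i (set js) = e"
      if "set js = e - {i}" "distinct js" for js
      using that ce e distinct_card[of js] by auto
    show ?thesis
      unfolding permutations_of_set_def
    proof (intro Collect_cong iffI)
      fix js assume "js \<in> ?J \<and> insert i (set js) = e"
      then show "set js = e - {i} \<and> distinct js"
        by (intro forward) simp_all
    next
      fix js assume "set js = e - {i} \<and> distinct js"
      then have "length js = k - 1 \<and> insert i (set js) = e"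
        by (intro backward) simp_all
      then show "js \<in> ?J \<and> insert i (set js) = e"
        using e(1) by simp
    qed
  qed
  have "tensor_apply k (adjacency_tensor k E) x $ i
      = (\<Sum>js\<in>?J. prod_list (map (($) x) js) / fact (k - 1))"
    unfolding tensor_apply_def adjacency_tensor_def vec_lambda_beta
    by (rule sum.mono_neutral_cong_right[OF fin]) (auto split: if_splits)
  \<comment> \<open>The lists are grouped by the edge that they form together with
    \<open>i\<close>.\<close>
  also have "\<dots> = (\<Sum>e | e \<in> E \<and> i \<in> e. \<Sum>js | js \<in> ?J \<and> insert i (set js) = e.
      prod_list (map (($) x) js) / fact (k - 1))"
    by (rule sum.group[symmetric]) (auto intro: finite_subset[OF _ fin])
  also have "\<dots> = (\<Sum>e | e \<in> E \<and> i \<in> e. \<Prod>j\<in>e - {i}. x $ j)"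
  proof (rule sum.cong[OF refl])
    fix e assume "e \<in> {e \<in> E. i \<in> e}"
    then have e: "e \<in> E" "i \<in> e" by auto
    have "(\<Sum>js | js \<in> ?J \<and> insert i (set js) = e. prod_list (map (($) x) js) / fact (k - 1))
        = (\<Sum>js\<in>permutations_of_set (e - {i}). (\<Prod>j\<in>e - {i}. x $ j) / fact (k - 1))"
    proof (rule sum.cong[OF perms[OF e]])
      fix js assume "js \<in> permutations_of_set (e - {i})"
      then have "set js = e - {i}" "distinct js"
        by (auto simp: permutations_of_set_def)
      then show "prod_list (map (($) x) js) / fact (k - 1) = (\<Prod>j\<in>e - {i}. x $ j) / fact (k - 1)"
        using prod.distinct_set_conv_list[of js "($) x"] by simp
    qed
    also have "\<dots> = (\<Prod>j\<in>e - {i}. x $ j)"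
      by (simp add: card_edge_remove[OF assms(1) e])
    finally show "(\<Sum>js | js \<in> ?J \<and> insert i (set js) = e. prod_list (map (($) x) js) / fact (k - 1))
        = (\<Prod>j\<in>e - {i}. x $ j)" .
  qed
  finally show ?thesis .
qed

section \<open>The spectral radius of a regular hypergraph\<close>

text \<open>Each of the \<open>d\<close> edges at \<open>i\<close> contributes
  \<open>(x $ i) ^ (k - 1)\<close>. This serves both the all-ones vector and one half of the
  description of the eigenvectors.\<close>

lemma edge_constant_imp_eigenvector:
  fixes E :: "'n::finite set set"
  assumes "uniform_hypergraph k E" "regular_hypergraph d E" "k \<ge> 1" "x \<noteq> 0"
    and "\<And>e u v. e \<in> E \<Longrightarrow> u \<in> e \<Longrightarrow> v \<in> e \<Longrightarrow> x $ u = x $ v"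
  shows "tensor_eigenpair k (adjacency_tensor k E) (of_nat d) x"
proof -
  have "tensor_apply k (adjacency_tensor k E) x $ i = of_nat d * (x $ i) ^ (k - 1)" for i
  proof -
    have "(\<Sum>e | e \<in> E \<and> i \<in> e. \<Prod>j\<in>e - {i}. x $ j) = (\<Sum>e | e \<in> E \<and> i \<in> e. (x $ i) ^ (k - 1))"
    proof (rule sum.cong[OF refl])
      fix e assume "e \<in> {e \<in> E. i \<in> e}"
      then have e: "e \<in> E" "i \<in> e" by auto
      have "(\<Prod>j\<in>e - {i}. x $ j) = (\<Prod>j\<in>e - {i}. x $ i)"
        using e by (intro prod.cong refl assms(5)[of e]) simp_all
      then show "(\<Prod>j\<in>e - {i}. x $ j) = (x $ i) ^ (k - 1)"
        using card_edge_remove[OF assms(1) e] by simp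
    qed
    then show ?thesis
      using assms(1-3) by (simp add: tensor_apply_adjacency regular_hypergraph_def)
  qed
  then show ?thesis
    using assms(4) by (simp add: tensor_eigenpair_def vec_eq_iff)
qed

text \<open>At a coordinate \<open>i\<close> of largest modulus \<open>M\<close>, each of the
  \<open>d\<close> edge products has modulus at most \<open>M ^ (k - 1)\<close>, and
  \<open>M\<close> is positive, so this power can be cancelled.\<close>

lemma tensor_eigenvalue_le_degree:
  fixes E :: "'n::finite set set"
  assumes "uniform_hypergraph k E" "regular_hypergraph d E" "k \<ge> 1"
    and "tensor_eigenpair k (adjacency_tensor k E) c x"
  shows "cmod c \<le> d"
proof -
  have "Max (range (\<lambda>j. cmod (x $ j))) \<in> range (\<lambda>j. cmod (x $ j))"
    by (intro Max_in) auto
  then obtain i where "cmod (x $ i) = Max (range (\<lambda>j. cmod (x $ j)))"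
    by (metis imageE)
  then have i: "cmod (x $ j) \<le> cmod (x $ i)" for j
    by simp
  define M where "M = cmod (x $ i)"
  have "x \<noteq> 0"
    using assms(4) by (simp add: tensor_eigenpair_def)
  then obtain j where "x $ j \<noteq> 0"
    by (auto simp: vec_eq_iff)
  then have "M > 0"
    using i[of j] unfolding M_def by (meson less_le_trans zero_less_norm_iff)
  have "c * (x $ i) ^ (k - 1) = (\<Sum>e | e \<in> E \<and> i \<in> e. \<Prod>j\<in>e - {i}. x $ j)"
    using assms(4) tensor_apply_adjacency[OF assms(1,3), of x i] by (simp add: tensor_eigenpair_def)
  then have "cmod c * M ^ (k - 1) = cmod (\<Sum>e | e \<in> E \<and> i \<in> e. \<Prod>j\<in>e - {i}. x $ j)"
    by (metis M_def norm_mult norm_power)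
  also have "\<dots> \<le> (\<Sum>e | e \<in> E \<and> i \<in> e. M ^ (k - 1))"
  proof (rule sum_norm_le)
    fix e assume "e \<in> {e \<in> E. i \<in> e}"
    then have e: "e \<in> E" "i \<in> e" by auto
    have "cmod (\<Prod>j\<in>e - {i}. x $ j) \<le> (\<Prod>j\<in>e - {i}. M)"
      unfolding prod_norm[symmetric] using i by (intro prod_mono) (auto simp: M_def)
    then show "cmod (\<Prod>j\<in>e - {i}. x $ j) \<le> M ^ (k - 1)"
      using card_edge_remove[OF assms(1) e] by simp
  qed
  also have "\<dots> = d * M ^ (k - 1)"
    using assms(2) by (simp add: regular_hypergraph_def)
  finally show ?thesis
    using \<open>M > 0\<close> by simp
qed

lemma spectral_radius_regular:
  fixes E :: "'n::finite set set"
  assumes "uniform_hypergraph k E" "regular_hypergraph d E" "k \<ge> 1"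
  shows "tensor_spectral_radius k (adjacency_tensor k E) = d"
  unfolding tensor_spectral_radius_def
proof (rule Greatest_equality)
  \<comment> \<open>The all-ones vector attains the bound, so the \<open>GREATEST\<close> value
    exists and is \<open>d\<close>.\<close>
  have "tensor_eigenpair k (adjacency_tensor k E) (of_nat d) 1"
    by (rule edge_constant_imp_eigenvector[OF assms]) (auto simp: vec_eq_iff)
  then show "\<exists>c x. tensor_eigenpair k (adjacency_tensor k E) c x \<and> real d = cmod c"
    by (intro exI[of _ "of_nat d"] exI[of _ 1]) simp
qed (use tensor_eigenvalue_le_degree[OF assms] in blast)

section \<open>Nonnegative eigenvectors for the spectral radius\<close>

text \<open>A global maximum of \<open>x\<close> could lie in a component where \<open>x\<close> is
  constant and give no contradiction. Maximising over the set \<open>B\<close> of vertices with a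
  differing neighbour avoids splitting into components.\<close>

lemma nonneg_eigenvector_imp_edge_constant:
  fixes E :: "'n::finite set set" and x :: "real ^ 'n"
  assumes uni: "uniform_hypergraph k E" and reg: "regular_hypergraph d E"
    and nn: "\<And>i. 0 \<le> x $ i"
    and eig: "\<And>i. (\<Sum>e | e \<in> E \<and> i \<in> e. \<Prod>j\<in>e - {i}. x $ j) = d * (x $ i) ^ (k - 1)"
    and "e \<in> E" "u \<in> e" "v \<in> e"
  shows "x $ u = x $ v"
proof (rule ccontr)
  assume "x $ u \<noteq> x $ v"
  define B where "B = {i. \<exists>j. (i, j) \<in> hg_adjacent E \<and> x $ j \<noteq> x $ i}"
  have "u \<in> B"
    using \<open>x $ u \<noteq> x $ v\<close> assms(5-7) by (auto simp: B_def hg_adjacent_def)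
  then have "Max ((($) x) ` B) \<in> (($) x) ` B"
    by (intro Max_in) auto
  then obtain i where i: "i \<in> B" "x $ i = Max ((($) x) ` B)"
    by (metis imageE)
  have i_max: "x $ j \<le> x $ i" if "j \<in> B" for j
    using that by (simp add: i(2))
  \<comment> \<open>Differing is symmetric: a neighbour of \<open>i\<close> with another value is
    itself in \<open>B\<close>, hence bounded by the maximum.\<close>
  have nbr: "x $ j \<le> x $ i" if "e \<in> E" "i \<in> e" "j \<in> e" for e j
  proof (cases "x $ j = x $ i")
    case False
    then have "j \<in> B"
      using that by (force simp: B_def hg_adjacent_def)
    then show ?thesis
      by (rule i_max)
  qed simp
  obtain f j where f: "f \<in> E" "i \<in> f" "j \<in> f" "x $ j \<noteq> x $ i"
    using i(1) by (auto simp: B_def hg_adjacent_def)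
  then have less: "x $ j < x $ i"
    using nbr[of f j] by simp
  have le: "(\<Prod>j\<in>e - {i}. x $ j) \<le> (x $ i) ^ (k - 1)" if e: "e \<in> E" "i \<in> e" for e
  proof -
    have "(\<Prod>j\<in>e - {i}. x $ j) \<le> (\<Prod>j\<in>e - {i}. x $ i)"
      using nn nbr e by (intro prod_mono) auto
    then show ?thesis
      using card_edge_remove[OF uni e] by simp
  qed
  have "(\<Prod>l\<in>f - {i}. x $ l) < (x $ i) ^ (k - 1)"
  proof -
    have j: "j \<in> f - {i}"
      using f by auto
    have "(\<Prod>l\<in>f - {i}. x $ l) = x $ j * (\<Prod>l\<in>f - {i} - {j}. x $ l)"
      using j by (intro prod.remove) auto
    also have "\<dots> \<le> x $ j * (\<Prod>l\<in>f - {i} - {j}. x $ i)"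
      using nn nbr f by (intro mult_left_mono prod_mono) auto
    \<comment> \<open>Since \<open>x $ i\<close> exceeds the nonnegative \<open>x $ j\<close>, it is
      positive, and so is the remaining product; this makes the inequality strict.\<close>
    also have "\<dots> < x $ i * (\<Prod>l\<in>f - {i} - {j}. x $ i)"
      using less nn[of j] by (intro mult_strict_right_mono prod_pos) auto
    also have "\<dots> = (\<Prod>l\<in>f - {i}. x $ i)"
      using j by (intro prod.remove[symmetric]) auto
    finally show ?thesis
      using card_edge_remove[OF uni f(1,2)] by simp
  qed
  then have "(\<Sum>e | e \<in> E \<and> i \<in> e. \<Prod>j\<in>e - {i}. x $ j) < (\<Sum>e | e \<in> E \<and> i \<in> e. (x $ i) ^ (k - 1))"
    using le f by (intro sum_strict_mono_ex1) auto
  also have "\<dots> = d * (x $ i) ^ (k - 1)"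
    using reg by (simp add: regular_hypergraph_def)
  finally show False
    using eig[of i] by simp
qed

text \<open>Apart from sign and nonvanishing, the eigenvalue equation turns into linear conditions,
  which opens the way to dimension counting.\<close>

lemma rho_nonneg_eigenvectors_regular:
  fixes E :: "'n::finite set set"
  assumes "uniform_hypergraph k E" "regular_hypergraph d E" "k \<ge> 1"
  shows "rho_nonneg_eigenvectors k E =
    {x. (\<forall>i. 0 \<le> x $ i) \<and> x \<noteq> 0 \<and> (\<forall>e\<in>E. \<forall>u\<in>e. \<forall>v\<in>e. x $ u = x $ v)}"
proof (intro equalityI subsetI)
  fix x assume "x \<in> rho_nonneg_eigenvectors k E"
  then have nn: "\<And>i. 0 \<le> x $ i"
    and eig: "tensor_eigenpair k (adjacency_tensor k E) (of_nat d) (\<chi> i. complex_of_real (x $ i))"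
    by (auto simp: rho_nonneg_eigenvectors_def spectral_radius_regular[OF assms])
  have "(\<Sum>e | e \<in> E \<and> i \<in> e. \<Prod>j\<in>e - {i}. x $ j) = d * (x $ i) ^ (k - 1)" for i
  proof -
    \<comment> \<open>Both sides of the complex equation are images of reals, so it descends by
      injectivity of the embedding.\<close>
    have "complex_of_real (\<Sum>e | e \<in> E \<and> i \<in> e. \<Prod>j\<in>e - {i}. x $ j)
        = complex_of_real (d * (x $ i) ^ (k - 1))"
      using eig tensor_apply_adjacency[OF assms(1,3), of "\<chi> i. complex_of_real (x $ i)" i]
      by (simp add: tensor_eigenpair_def)
    then show ?thesis
      unfolding of_real_eq_iff .
  qed
  note const = nonneg_eigenvector_imp_edge_constant[OF assms(1,2) nn this]
  have "x \<noteq> 0"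
    using eig by (auto simp: tensor_eigenpair_def vec_eq_iff)
  then show "x \<in> {x. (\<forall>i. 0 \<le> x $ i) \<and> x \<noteq> 0 \<and> (\<forall>e\<in>E. \<forall>u\<in>e. \<forall>v\<in>e. x $ u = x $ v)}"
    using nn const by blast
next
  fix x :: "real ^ 'n"
  assume x: "x \<in> {x. (\<forall>i. 0 \<le> x $ i) \<and> x \<noteq> 0 \<and> (\<forall>e\<in>E. \<forall>u\<in>e. \<forall>v\<in>e. x $ u = x $ v)}"
  have "tensor_eigenpair k (adjacency_tensor k E) (of_nat d) (\<chi> i. complex_of_real (x $ i))"
  proof (rule edge_constant_imp_eigenvector[OF assms])
    have "x \<noteq> 0"
      using x by simp
    then show "(\<chi> i. complex_of_real (x $ i)) \<noteq> 0"
      by (simp add: vec_eq_iff)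
    fix e u v assume "e \<in> E" "u \<in> e" "v \<in> e"
    with x have "x $ u = x $ v"
      by blast
    then show "(\<chi> i. complex_of_real (x $ i)) $ u = (\<chi> i. complex_of_real (x $ i)) $ v"
      by simp
  qed
  moreover have "\<forall>i. 0 \<le> x $ i"
    using x by blast
  ultimately show "x \<in> rho_nonneg_eigenvectors k E"
    by (simp add: rho_nonneg_eigenvectors_def spectral_radius_regular[OF assms])
qed

section \<open>Indicator vectors of equivalence classes\<close>

definition indicator_vec :: "'n::finite set \<Rightarrow> real ^ 'n" where
  "indicator_vec X = (\<chi> i. if i \<in> X then 1 else 0)"

lemma inj_indicator_vec: "inj indicator_vec"
  by (rule injI) (auto simp: indicator_vec_def vec_eq_iff split: if_splits)

text \<open>Distinct classes are disjoint, which gives orthogonality, and classes are nonempty,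
  which excludes the zero vector.\<close>

lemma independent_indicator_vec_quotient:
  fixes R :: "('n::finite \<times> 'n) set"
  assumes "equiv UNIV R"
  shows "independent (indicator_vec ` (UNIV // R))"
proof (rule pairwise_orthogonal_independent)
  show "pairwise orthogonal (indicator_vec ` (UNIV // R))"
  proof (rule pairwise_imageI)
    fix X Y assume "X \<in> UNIV // R" "Y \<in> UNIV // R" "X \<noteq> Y"
    then have "X \<inter> Y = {}"
      using quotient_disj[OF assms] by blast
    then show "orthogonal (indicator_vec X) (indicator_vec Y)"
      unfolding orthogonal_def inner_vec_def
      by (intro sum.neutral) (auto simp: indicator_vec_def)
  qed
  show "0 \<notin> indicator_vec ` (UNIV // R)"
    using in_quotient_imp_non_empty[OF assms]
    by (fastforce simp: indicator_vec_def vec_eq_iff split: if_splits)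
qed

lemma class_constant_in_span_indicator_vec:
  fixes R :: "('n::finite \<times> 'n) set" and x :: "real ^ 'n"
  assumes "equiv UNIV R" and const: "\<And>u v. (u, v) \<in> R \<Longrightarrow> x $ u = x $ v"
  shows "x \<in> span (indicator_vec ` (UNIV // R))"
proof -
  \<comment> \<open>The coefficient of a class is the common value of \<open>x\<close> on it, read
    off at an arbitrary member.\<close>
  have "x = (\<Sum>X\<in>UNIV // R. x $ (SOME v. v \<in> X) *\<^sub>R indicator_vec X)"
  proof (subst vec_eq_iff, rule allI)
    fix i
    have iC: "i \<in> R `` {i}" and C: "R `` {i} \<in> UNIV // R"
      using equiv_class_self[OF assms(1)] by (auto intro: quotientI)
    \<comment> \<open>By disjointness only the class of \<open>i\<close> contributes at coordinate
      \<open>i\<close>.\<close>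
    have "(\<Sum>X\<in>UNIV // R. x $ (SOME v. v \<in> X) *\<^sub>R indicator_vec X) $ i
        = (\<Sum>X\<in>UNIV // R. if X = R `` {i} then x $ (SOME v. v \<in> X) else 0)"
      unfolding sum_component
      using iC C quotient_disj[OF assms(1) _ C]
      by (intro sum.cong) (auto simp: indicator_vec_def)
    also have "\<dots> = x $ (SOME v. v \<in> R `` {i})"
      using C by simp
    also have "\<dots> = x $ i"
      using const[of i "SOME v. v \<in> R `` {i}"] someI[of "\<lambda>v. v \<in> R `` {i}", OF iC] by simp
    finally show "x $ i = (\<Sum>X\<in>UNIV // R. x $ (SOME v. v \<in> X) *\<^sub>R indicator_vec X) $ i"
      by simp
  qed
  also have "\<dots> \<in> span (indicator_vec ` (UNIV // R))"
    by (intro span_sum span_scale span_base) auto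
  finally show ?thesis .
qed

section \<open>Counting components by a basis of indicator vectors\<close>

theorem theorem3p5:
  fixes E :: "'n::finite set set" and k d :: nat
  assumes "k \<ge> 1"
    and "uniform_hypergraph k E"
    and "regular_hypergraph d E"
  shows "card {X. hg_component E X} = beta_rho k E"
proof -
  let ?R = "(hg_adjacent E)\<^sup>*"
  let ?B = "indicator_vec ` (UNIV // ?R) :: (real ^ 'n) set"
  note eq = equiv_rtrancl_hg_adjacent[of E]
  note eigenvectors = rho_nonneg_eigenvectors_regular[OF assms(2,3,1)]
  have cardB: "card ?B = card (UNIV // ?R)"
    by (rule card_image) (meson inj_indicator_vec inj_on_subset subset_UNIV)
  have indep: "independent ?B"
    by (rule independent_indicator_vec_quotient[OF eq])
  \<comment> \<open>Lower bound: \<open>?B\<close> is an admissible independent set.\<close>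
  have "?B \<subseteq> rho_nonneg_eigenvectors k E"
  proof
    fix x assume "x \<in> ?B"
    then obtain X where X: "X \<in> UNIV // ?R" "x = indicator_vec X"
      by auto
    have "x \<noteq> 0"
      using \<open>x \<in> ?B\<close> indep dependent_zero by metis
    moreover have "0 \<le> x $ i" for i
      by (simp add: X(2) indicator_vec_def)
    moreover have "x $ u = x $ v" if "e \<in> E" "u \<in> e" "v \<in> e" for e u v
    proof -
      have "(u, v) \<in> ?R" "(v, u) \<in> ?R"
        using that by (auto simp: hg_adjacent_def)
      then have "u \<in> X \<longleftrightarrow> v \<in> X"
        using in_quotient_imp_closed[OF eq X(1), of u v] in_quotient_imp_closed[OF eq X(1), of v u]
        by blast
      then show ?thesis
        by (simp add: X(2) indicator_vec_def)
    qed
    ultimately show "x \<in> rho_nonneg_eigenvectors k E"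
      unfolding eigenvectors by blast
  qed
  \<comment> \<open>Upper bound: constancy on edges propagates along chains of adjacencies to whole
    classes, so \<open>S\<close> lies in the span of \<open>?B\<close>.\<close>
  moreover have "card S \<le> card ?B" if S: "S \<subseteq> rho_nonneg_eigenvectors k E" "independent S" for S
  proof -
    have "S \<subseteq> span ?B"
    proof
      fix x assume "x \<in> S"
      then have edge: "\<And>e u v. e \<in> E \<Longrightarrow> u \<in> e \<Longrightarrow> v \<in> e \<Longrightarrow> x $ u = x $ v"
        using S(1) unfolding eigenvectors by blast
      have "x $ u = x $ v" if "(u, v) \<in> ?R" for u v
        using that
      proof induction
        case (step y z)
        then show ?case
          using edge by (auto simp: hg_adjacent_def)
      qed simp
      then show "x \<in> span ?B"
        by (rule class_constant_in_span_indicator_vec[OF eq])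
    qed
    then show ?thesis
      using independent_span_bound[OF _ S(2)] by auto
  qed
  \<comment> \<open>The upper bound also makes the set of cardinalities finite, as
    \<open>Max\<close> requires.\<close>
  ultimately have "beta_rho k E = card ?B"
    unfolding beta_rho_def using indep
    by (intro Max_eqI) (auto intro: finite_subset[of _ "{..card ?B}"])
  then show ?thesis
    by (simp add: cardB hg_components_eq_quotient)
qed

end
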